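(* Let $n\ge2$, $f$ a smooth positive function and $g=-f(r)\,dt^2+f(r)^{-1}dr^2+d\omega_{n-1}^2$. Introduce $x$ by $r=-\tan(x-\pi/2)$, with $x\in(0,x_0)$ for a constant $0<x_0<\pi/2$, and set $M=\mathbb R\times(0,x_0)\times S^{n-1}$ (coordinates $t,x,\omega$), $F(x)=f(r(x))$, $\Omega(x)=F(x)^{-1/2}$, $G(x)=\csc^2(x)/F(x)$, $a(x)=\sqrt{F(x)}\sin^2 x$, so that $g=\Omega^{-2}\overline g$ with $\overline g=-dt^2+G(x)^2\big(dx^2+a(x)^2d\omega_{n-1}^2\big)$. Let $b(x)=\exp\big(\int_{x_0}^x a(s)^{-1}ds\big)$ and let $\overline M=\mathbb R\times\{y\in\mathbb R^n:|y|<1\}$, in which $M$ is identified with $\{y\neq0\}$ via $y=b(x)\omega$ ($\omega\in S^{n-1}\subset\mathbb R^n$), and let $\mathcal J=\mathbb R\times\{0\}$ (the locus $x=0$). Suppose $a$ is smooth and $a(x)=x+O(x^2)$, $a'(x)=1+O(x)$ as $x\to0$. Then: $\overline g$ extends to a Lipschitz Lorentzian metric on $\overline M$ for which $\mathcal J$ is a smooth inextendible timelike curve with $\partial M=\mathcal J$; $\Omega$ extends continuously to $\overline M$ with $\Omega=0$ on $\mathcal J$, $\Omega>0$ smooth on $M$, and $d\Omega$ is bounded on a neighbourhood of $\mathcal J$ minus $\mathcal J$; and $\overline g=\Omega^2 g$ on $M$. (That is, conditions (ii), (iii), (iv) of the definition of asymptotically $\mathrm{AdS}_2\times S^{n-1}$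 ends hold with $\mathcal J$ given by $x=0$.)
   Context: Here $d\omega_{n-1}^2$ is the round unit metric on $S^{n-1}$. The definition referred to: a smooth spacetime $(M,g)$ has asymptotically $\mathrm{AdS}_2\times S^{n-1}$ ends if there exist $(\overline M,\overline g)$ with locally Lipschitz Lorentzian $\overline g$ and $\Omega\in C^{0,1}(\overline M)$ with (i) $(\overline M,\overline g)$ globally hyperbolic; (ii) $M\subset\overline M$ and $\partial M=\mathcal J$ a disjoint union of smooth inextendible timelike curves; (iii) $\Omega|_M$ smooth, $\Omega>0$ on $M$, $\Omega=0$ on $\mathcal J$, each point of $\mathcal J$ has a neighborhood $U$ with $U\cap\mathcal J$ connected and $d\Omega$ bounded on $U\setminus\mathcal J$; (iv) $\overline g=\Omega^2g$ on $M$. *)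

theory Defs
  imports "HOL-Analysis.Analysis" "HOL-Library.Landau_Symbols"
begin

fun iter_dderiv :: "'a::real_normed_vector list \<Rightarrow> ('a \<Rightarrow> real) \<Rightarrow> 'a \<Rightarrow> real" where
  "iter_dderiv [] f = f"
| "iter_dderiv (v # vs) f = (\<lambda>x. frechet_derivative (iter_dderiv vs f) (at x) v)"

text \<open>Smoothness (C-infinity) of a real-valued function on an open set S: all iterated
  derivatives exist (and hence are continuous) at every point of S.\<close>
definition smooth_on :: "'a::real_normed_vector set \<Rightarrow> ('a \<Rightarrow> real) \<Rightarrow> bool" where
  "smooth_on S f \<longleftrightarrow> (\<forall>vs. \<forall>x\<in>S. iter_dderiv vs f differentiable (at x))"

definition smooth_map_on :: "'a::real_normed_vector set \<Rightarrow> ('a \<Rightarrow> 'b::real_inner) \<Rightarrow> bool" where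
  "smooth_map_on S \<gamma> \<longleftrightarrow> (\<forall>u. smooth_on S (\<lambda>t. \<gamma> t \<bullet> u))"

definition locally_lipschitz_on :: "'a::metric_space set \<Rightarrow> ('a \<Rightarrow> 'b::metric_space) \<Rightarrow> bool" where
  "locally_lipschitz_on S f \<longleftrightarrow> (\<forall>p\<in>S. \<exists>e>0. \<exists>C. C-lipschitz_on (ball p e \<inter> S) f)"

definition lorentzian_form :: "(real \<times> (real^'n) \<Rightarrow> real \<times> (real^'n) \<Rightarrow> real) \<Rightarrow> bool" where
  "lorentzian_form B \<longleftrightarrow>
     (\<exists>L :: real \<times> (real^'n) \<Rightarrow> real \<times> (real^'n). linear L \<and> bij L \<and> (\<forall>u v. B (L u) (L v) = - (fst u * fst v) + snd u \<bullet> snd v))"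

definition r_of :: "real \<Rightarrow> real" where
  "r_of x = - tan (x - pi / 2)"

definition F_of :: "(real \<Rightarrow> real) \<Rightarrow> real \<Rightarrow> real" where
  "F_of f x = f (r_of x)"

definition Omega_of :: "(real \<Rightarrow> real) \<Rightarrow> real \<Rightarrow> real" where
  "Omega_of f x = F_of f x powr (-1/2)"

definition G_of :: "(real \<Rightarrow> real) \<Rightarrow> real \<Rightarrow> real" where
  "G_of f x = (1 / sin x)^2 / F_of f x"

definition a_of :: "(real \<Rightarrow> real) \<Rightarrow> real \<Rightarrow> real" where
  "a_of f x = sqrt (F_of f x) * (sin x)^2"

text \<open>b(x) = exp (int_{x0}^x 1/a(s) ds), written for x \<le> x0 as exp(- int_{[x,x0]} 1/a).\<close>
definition b_of :: "(real \<Rightarrow> real) \<Rightarrow> real \<Rightarrow> real \<Rightarrow> real" where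
  "b_of f x0 x = exp (- integral {x..x0} (\<lambda>s. 1 / a_of f s))"

definition M_coords :: "real \<Rightarrow> (real \<times> real \<times> (real^'n)) set" where
  "M_coords x0 = {(t, x, w). 0 < x \<and> x < x0 \<and> norm w = 1}"

definition Phi :: "(real \<Rightarrow> real) \<Rightarrow> real \<Rightarrow> real \<times> real \<times> (real^'n) \<Rightarrow> real \<times> (real^'n)" where
  "Phi f x0 p = (case p of (t, x, w) \<Rightarrow> (t, b_of f x0 x *\<^sub>R w))"

definition Mbar :: "(real \<times> (real^'n)) set" where
  "Mbar = {(t, y). norm y < 1}"

definition J_set :: "(real \<times> (real^'n)) set" where
  "J_set = {(t, y). y = 0}"

end

(* In the coordinate y the metric gbar equals -dt^2 + h(x)^2 |dy|^2 with the single conformal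
   factor h = G a / b = sin^2 x / (a b).  Since (log h)' = (2 a cot x - a' - 1) / a, the expansions
   of a and a' make (log h)' bounded near x = 0.  Hence h has a positive limit there, so b is
   comparable to x, and the derivatives of h^2 and of Omega = sin^2 x / a with respect to |y| = b(x)
   stay bounded.  This gives the Lipschitz extensions across J.  Away from J everything is a smooth
   function of |y|^2. *)
theory Submission
  imports Defs "HOL-Real_Asymp.Real_Asymp"
begin

text \<open>The equation b'/b = 1/a is exactly what turns dx^2 + a^2 d omega^2 into (a/b)^2 |dy|^2,
  so one scalar function carries the whole spatial metric and the singularity of polar coordinates
  disappears. What remains at risk is regularity. Differentiation in |y| is (a/b) d/dx, and the
  hypotheses on a are bounds without further terms of an expansion, so (log h)' need not have a
  limit at x = 0: a Lipschitz extension is what can be expected. Even its boundedness depends on a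
  cancellation, because 1/a is singular: the leading terms 2 - 1 - 1 of the numerator add up to
  zero. At the outer end |y| = 1 the derivative of a is not controlled, so Lipschitz constants are
  taken on |y| \<le> R with R < 1. Away from the axis the obstacle is the smoothness of the inverse
  of b; it is read off from a differential equation for the inverse in which only a occurs.\<close>

section \<open>Calculus of smooth real-valued functions\<close>

text \<open>Built from the innermost derivative outwards, whereas \<^const>\<open>iter_dderiv\<close> peels off the
  outermost one; this orientation makes the closure properties simple inductions on the order.\<close>
primrec ndiff :: "nat \<Rightarrow> 'a::real_normed_vector set \<Rightarrow> ('a \<Rightarrow> real) \<Rightarrow> bool" where
  "ndiff 0 S f \<longleftrightarrow> True"
| "ndiff (Suc n) S f \<longleftrightarrow>
     (\<forall>x\<in>S. f differentiable (at x)) \<and> (\<forall>v. ndiff n S (\<lambda>x. frechet_derivative f (at x) v))"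

lemma iter_dderiv_snoc:
  "iter_dderiv (vs @ [v]) f = iter_dderiv vs (\<lambda>x. frechet_derivative f (at x) v)"
  by (induction vs) auto

lemma ndiff_iff_iter_dderiv:
  "ndiff n S f \<longleftrightarrow> (\<forall>vs. length vs < n \<longrightarrow> (\<forall>x\<in>S. iter_dderiv vs f differentiable (at x)))"
proof (induction n arbitrary: f)
  case (Suc n)
  \<comment> \<open>The last list entry is the direction differentiated first, so the induction
    removes entries at the end of the list.\<close>
  have split: "(\<forall>vs. P vs) \<longleftrightarrow> P [] \<and> (\<forall>v vs. P (vs @ [v]))" for P :: "'a list \<Rightarrow> bool"
    by (metis rev_exhaust)
  show ?case
    by (subst split) (auto simp: Suc.IH iter_dderiv_snoc)
qed auto

lemma smooth_on_iff_ndiff: "smooth_on S f \<longleftrightarrow> (\<forall>n. ndiff n S f)"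
  unfolding smooth_on_def ndiff_iff_iter_dderiv by blast

lemma smooth_on_differentiable: "smooth_on S f \<Longrightarrow> x \<in> S \<Longrightarrow> f differentiable (at x)"
  unfolding smooth_on_def by (metis iter_dderiv.simps(1))

lemma smooth_on_frechet_derivative:
  "smooth_on S f \<Longrightarrow> smooth_on S (\<lambda>x. frechet_derivative f (at x) v)"
  unfolding smooth_on_def by (metis iter_dderiv_snoc)

text \<open>Derivatives see a neighbourhood, not just the point; openness of \<open>S\<close> makes
  agreement on \<open>S\<close> agreement near each of its points, and the induction can pass to the
  derivatives.\<close>

lemma ndiff_cong:
  assumes "open S" "\<And>x. x \<in> S \<Longrightarrow> f x = g x" "ndiff n S f"
  shows "ndiff n S g"
  using assms(2,3)
proof (induction n arbitrary: f g)
  case (Suc n)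
  have der: "(g has_derivative frechet_derivative f (at x)) (at x)" if "x \<in> S" for x
    by (rule has_derivative_transform_within_open[where f = f, OF _ assms(1) that])
       (use Suc.prems that in \<open>auto simp: frechet_derivative_works\<close>)
  have "frechet_derivative f (at x) = frechet_derivative g (at x)" if "x \<in> S" for x
    using der[OF that] by (rule frechet_derivative_at)
  then have "ndiff n S (\<lambda>x. frechet_derivative g (at x) v)" for v
    by (intro Suc.IH[where f = "\<lambda>x. frechet_derivative f (at x) v",
          OF _ Suc.prems(2)[simplified ndiff.simps, THEN conjunct2, rule_format]]) simp
  with der show ?case
    by (auto simp: differentiable_def)
qed auto

text \<open>Replaces the choice operator \<open>frechet_derivative\<close> by any explicit formula
  for the derivative; the closure rules below rest on this.\<close>

lemma ndiff_SucI:
  assumes "open S" "\<And>x. x \<in> S \<Longrightarrow> (f has_derivative f' x) (at x)"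
    and "\<And>v. ndiff n S (\<lambda>x. f' x v)"
  shows "ndiff (Suc n) S f"
proof -
  have "f' x = frechet_derivative f (at x)" if "x \<in> S" for x
    using assms(2)[OF that] by (rule frechet_derivative_at)
  then have "ndiff n S (\<lambda>x. frechet_derivative f (at x) v)" for v
    by (intro ndiff_cong[OF assms(1) _ assms(3)[of v]]) simp
  with assms(2) show ?thesis
    by (auto simp: differentiable_def)
qed

lemma ndiff_Suc_has_derivative:
  "ndiff (Suc n) S f \<Longrightarrow> x \<in> S \<Longrightarrow> (f has_derivative frechet_derivative f (at x)) (at x)"
  by (simp add: frechet_derivative_works)

lemma ndiff_Suc_imp: "ndiff (Suc n) S f \<Longrightarrow> ndiff n S f"
  by (induction n arbitrary: f) auto

lemma ndiff_const: "open S \<Longrightarrow> ndiff n S (\<lambda>x. c)"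
proof (induction n arbitrary: c)
  case (Suc n)
  then show ?case by (intro ndiff_SucI[where f' = "\<lambda>x v. 0"]) auto
qed auto

lemma ndiff_bounded_linear:
  assumes "open S" "bounded_linear f" shows "ndiff n S f"
proof (cases n)
  case (Suc m)
  have "ndiff (Suc m) S f"
    by (rule ndiff_SucI[OF assms(1) bounded_linear_imp_has_derivative[OF assms(2)]
          ndiff_const[OF assms(1)]])
  with Suc show ?thesis by simp
qed auto

lemma ndiff_add: "open S \<Longrightarrow> ndiff n S f \<Longrightarrow> ndiff n S g \<Longrightarrow> ndiff n S (\<lambda>x. f x + g x)"
proof (induction n arbitrary: f g)
  case (Suc n)
  show ?case
    by (rule ndiff_SucI[OF Suc.prems(1) has_derivative_add])
       (use Suc in \<open>auto simp: frechet_derivative_works\<close>)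
qed auto

lemma ndiff_mult: "open S \<Longrightarrow> ndiff n S f \<Longrightarrow> ndiff n S g \<Longrightarrow> ndiff n S (\<lambda>x. f x * g x)"
proof (induction n arbitrary: f g)
  case (Suc n)
  show ?case
    by (rule ndiff_SucI[OF Suc.prems(1) has_derivative_mult])
       (use Suc ndiff_Suc_imp[OF Suc.prems(2)] ndiff_Suc_imp[OF Suc.prems(3)]
         in \<open>auto simp: frechet_derivative_works intro!: ndiff_add\<close>)
qed auto

text \<open>The derivative -(1/f) f' (1/f) contains 1/f itself, but at one order lower, so the
  induction runs for a fixed \<open>f\<close>.\<close>

lemma ndiff_inverse:
  assumes "open S" "\<And>x. x \<in> S \<Longrightarrow> f x \<noteq> 0" "ndiff n S f"
  shows "ndiff n S (\<lambda>x. inverse (f x))"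
  using assms(3)
proof (induction n)
  case (Suc n)
  have "ndiff n S (\<lambda>x. (-1) * (inverse (f x) * frechet_derivative f (at x) v * inverse (f x)))" for v
    using Suc ndiff_Suc_imp[OF Suc.prems] assms(1) by (intro ndiff_mult ndiff_const) auto
  then show ?case
    by (intro ndiff_SucI[OF assms(1) Deriv.has_derivative_inverse])
       (use Suc.prems assms(2) in \<open>auto simp: frechet_derivative_works\<close>)
qed auto

lemma differentiable_imp_DERIV_frechet_derivative:
  fixes f :: "real \<Rightarrow> real"
  assumes "f differentiable (at x)"
  shows "(f has_real_derivative frechet_derivative f (at x) 1) (at x)"
proof -
  have d: "(f has_derivative frechet_derivative f (at x)) (at x)"
    using assms by (simp add: frechet_derivative_works)
  have "frechet_derivative f (at x) s = frechet_derivative f (at x) 1 * s" for s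
    using linear_cmul[OF has_derivative_linear[OF d], of s 1] by (simp add: mult.commute)
  then have "frechet_derivative f (at x) = (*) (frechet_derivative f (at x) 1)"
    by (rule ext)
  with d show ?thesis
    by (metis has_field_derivative_def)
qed

text \<open>The chain rule replaces \<open>\<phi>\<close> by its derivative and leaves
  \<open>g\<close> inside, so the induction ranges over all \<open>\<phi>\<close> with
  \<open>g\<close> fixed. As \<open>\<phi>\<close> has one real variable, its derivative is a number
  and the rule a plain product.\<close>

lemma ndiff_compose:
  fixes \<phi> :: "real \<Rightarrow> real"
  assumes "open S" "open T" "g ` S \<subseteq> T" "ndiff n S g" "ndiff n T \<phi>"
  shows "ndiff n S (\<lambda>x. \<phi> (g x))"
  using assms(4,5)
proof (induction n arbitrary: \<phi>)
  case (Suc n)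
  let ?D = "\<lambda>x. frechet_derivative g (at x)"
  have "((\<lambda>x. \<phi> (g x)) has_derivative (\<lambda>v. frechet_derivative \<phi> (at (g x)) 1 * ?D x v)) (at x)"
    if "x \<in> S" for x
  proof -
    have "(\<phi> has_real_derivative frechet_derivative \<phi> (at (g x)) 1) (at (g x))"
      using Suc.prems(2) assms(3) that
      by (intro differentiable_imp_DERIV_frechet_derivative) auto
    from has_derivative_compose[OF ndiff_Suc_has_derivative[OF Suc.prems(1) that]
        this[unfolded has_field_derivative_def]]
    show ?thesis .
  qed
  moreover have "ndiff n S (\<lambda>x. frechet_derivative \<phi> (at (g x)) 1 * ?D x v)" for v
    using Suc ndiff_Suc_imp[OF Suc.prems(1)] assms(1)
    by (intro ndiff_mult Suc.IH[where \<phi> = "\<lambda>y. frechet_derivative \<phi> (at y) 1"]) auto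
  ultimately show ?case
    by (intro ndiff_SucI[OF assms(1)])
qed auto

lemma smooth_on_const: "open S \<Longrightarrow> smooth_on S (\<lambda>x. c)"
  by (simp add: smooth_on_iff_ndiff ndiff_const)

lemma smooth_on_bounded_linear: "open S \<Longrightarrow> bounded_linear f \<Longrightarrow> smooth_on S f"
  by (simp add: smooth_on_iff_ndiff ndiff_bounded_linear)

lemma smooth_on_add: "open S \<Longrightarrow> smooth_on S f \<Longrightarrow> smooth_on S g \<Longrightarrow> smooth_on S (\<lambda>x. f x + g x)"
  by (simp add: smooth_on_iff_ndiff ndiff_add)

lemma smooth_on_mult: "open S \<Longrightarrow> smooth_on S f \<Longrightarrow> smooth_on S g \<Longrightarrow> smooth_on S (\<lambda>x. f x * g x)"
  by (simp add: smooth_on_iff_ndiff ndiff_mult)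

lemma smooth_on_inverse:
  "open S \<Longrightarrow> smooth_on S f \<Longrightarrow> (\<And>x. x \<in> S \<Longrightarrow> f x \<noteq> 0) \<Longrightarrow> smooth_on S (\<lambda>x. inverse (f x))"
  by (simp add: smooth_on_iff_ndiff ndiff_inverse)

lemma smooth_on_compose:
  fixes \<phi> :: "real \<Rightarrow> real"
  assumes "open S" "open T" "g ` S \<subseteq> T" "smooth_on S g" "smooth_on T \<phi>"
  shows "smooth_on S (\<lambda>x. \<phi> (g x))"
  using assms ndiff_compose[OF assms(1-3)] by (simp add: smooth_on_iff_ndiff)

lemma smooth_on_cong:
  "open S \<Longrightarrow> (\<And>x. x \<in> S \<Longrightarrow> f x = g x) \<Longrightarrow> smooth_on S f \<Longrightarrow> smooth_on S g"
  by (meson ndiff_cong smooth_on_iff_ndiff)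

lemma smooth_on_sin:
  fixes S :: "real set"
  assumes "open S" shows "smooth_on S sin"
proof -
  \<comment> \<open>The span of sin and cos is closed under differentiation, while sin alone is not;
    hence the two coefficients.\<close>
  have "ndiff n S (\<lambda>x. A * sin x + B * cos x)" for n A B
  proof (induction n arbitrary: A B)
    case (Suc n)
    show ?case
    proof (rule ndiff_SucI[OF assms])
      show "((\<lambda>x. A * sin x + B * cos x) has_derivative (\<lambda>v. (- B * v) * sin x + (A * v) * cos x)) (at x)" for x
        by (auto intro!: derivative_eq_intros simp: algebra_simps)
    qed (rule Suc.IH)
  qed auto
  from this[of _ 1 0] show ?thesis by (simp add: smooth_on_iff_ndiff)
qed

text \<open>The functions \<open>\<phi> (Y s) / s ^ k\<close> with smooth \<open>\<phi>\<close> are closed under differentiation, so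
  no smooth inverse function theorem is needed.\<close>
lemma smooth_on_ode_solution:
  fixes Y a \<phi> :: "real \<Rightarrow> real"
  assumes "open S" "0 \<notin> S" "open T" "Y ` S \<subseteq> T"
    and Y: "\<And>s. s \<in> S \<Longrightarrow> (Y has_real_derivative a (Y s) / (2 * s)) (at s)"
    and a: "smooth_on T a" and \<phi>: "smooth_on T \<phi>"
  shows "smooth_on S (\<lambda>s. \<phi> (Y s))"
proof -
  have "ndiff n S (\<lambda>s. \<phi> (Y s) * (1 / s) ^ k)" if "smooth_on T \<phi>" for n k \<phi>
    using that
  proof (induction n arbitrary: k \<phi>)
    case (Suc n)
    \<comment> \<open>Differentiating \<open>\<phi> (Y s) / s ^ k\<close> gives \<phi>' a / (2
      s^(k+1)) - k \<phi> / s^(k+1): the same shape with \<open>k\<close> raised by one and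
      \<open>\<phi>\<close> replaced by this function.\<close>
    let ?\<psi> = "\<lambda>v x. v * (frechet_derivative \<phi> (at x) 1 * a x * (1 / 2) + (- real k) * \<phi> x)"
    show ?case
    proof (rule ndiff_SucI[OF assms(1)])
      fix s assume s: "s \<in> S"
      then have "Y s \<in> T" and "s \<noteq> 0" using assms by auto
      then have d: "(\<phi> has_real_derivative frechet_derivative \<phi> (at (Y s)) 1) (at (Y s))"
        using Suc.prems
        by (intro differentiable_imp_DERIV_frechet_derivative) (auto dest: smooth_on_differentiable)
      show "((\<lambda>s. \<phi> (Y s) * (1 / s) ^ k) has_derivative
              (\<lambda>v. ?\<psi> v (Y s) * (1 / s) ^ Suc k)) (at s)"
      proof -
        have "((\<lambda>s. \<phi> (Y s)) has_real_derivative
            frechet_derivative \<phi> (at (Y s)) 1 * (a (Y s) / (2 * s))) (at s)"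
          by (rule DERIV_chain2[where f = \<phi> and g = Y, OF d Y[OF s]])
        moreover have "((\<lambda>s. (1 / s) ^ k) has_real_derivative - real k * (1 / s) ^ Suc k) (at s)"
        proof (induction k)
          case (Suc k)
          have "((\<lambda>s. 1 / s) has_real_derivative - ((1 / s) * (1 / s))) (at s)"
            using \<open>s \<noteq> 0\<close> by (auto intro!: derivative_eq_intros)
          then show ?case
            unfolding power_Suc
            by (rule DERIV_mult[OF _ Suc.IH, THEN DERIV_cong])
               (simp add: algebra_simps add_divide_distrib diff_divide_distrib)
        qed auto
        ultimately have "((\<lambda>s. \<phi> (Y s) * (1 / s) ^ k) has_real_derivative
              ?\<psi> 1 (Y s) * (1 / s) ^ Suc k) (at s)"
          by (rule DERIV_mult[THEN DERIV_cong]) (simp add: algebra_simps)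
        then show ?thesis
          unfolding has_field_derivative_def by (rule has_derivative_eq_rhs) (auto simp: algebra_simps)
      qed
    next
      have "smooth_on T (?\<psi> v)" for v
        using smooth_on_frechet_derivative[OF Suc.prems] a Suc.prems
        by (intro smooth_on_mult[OF \<open>open T\<close>] smooth_on_add[OF \<open>open T\<close>]
            smooth_on_const[OF \<open>open T\<close>])
      then show "ndiff n S (\<lambda>s. ?\<psi> v (Y s) * (1 / s) ^ Suc k)" for v
        by (rule Suc.IH)
    qed
  qed auto
  from this[OF \<phi>, of _ 0] show ?thesis by (simp add: smooth_on_iff_ndiff)
qed

section \<open>The substitution r = cot x\<close>

lemma r_of_eq_cot: "r_of x = cot x"
  by (simp add: r_of_def tan_def cot_def sin_diff cos_diff)

lemma DERIV_r_of: "sin x \<noteq> 0 \<Longrightarrow> (r_of has_real_derivative - (1 / sin x)\<^sup>2) (at x)"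
  unfolding r_of_eq_cot[abs_def]
  by (rule DERIV_cot[THEN DERIV_cong]) (simp_all add: divide_simps)

lemma r_of_antimono: "0 < x \<Longrightarrow> x \<le> y \<Longrightarrow> y < pi \<Longrightarrow> r_of y \<le> r_of x"
proof -
  assume "0 < x" "x \<le> y" "y < pi"
  then have "tan (x - pi / 2) \<le> tan (y - pi / 2)"
    by (intro tan_mono_le) auto
  then show ?thesis by (simp add: r_of_def)
qed

lemma onorm_mult_real_le: "\<bar>c\<bar> \<le> C \<Longrightarrow> onorm ((*) c) \<le> C" for c C :: real
  by (rule onorm_bound) (auto simp: abs_mult intro!: mult_right_mono)

section \<open>The radial coordinate b and the limit of the conformal factor\<close>

text \<open>The data that depend on x alone. Neither t nor the dimension enters, so all estimates
  are statements about real functions of one variable.\<close>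

locale radial_profile =
  fixes f :: "real \<Rightarrow> real" and x0 :: real and D :: "real set"
  assumes x0: "0 < x0" "x0 < pi / 2"
    and D: "{r_of x0..} \<subseteq> D"
    and f_cont: "continuous_on D f" and f_pos: "\<forall>r\<in>D. f r > 0"
    and a_smooth: "smooth_on {0<..<x0} (a_of f)"
    and a_asym: "(\<lambda>x. a_of f x - x) \<in> O[at_right 0](\<lambda>x. x ^ 2)"
    and a'_asym: "(\<lambda>x. deriv (a_of f) x - 1) \<in> O[at_right 0](\<lambda>x. x)"
begin

abbreviation "a \<equiv> a_of f"
abbreviation "b \<equiv> b_of f x0"
abbreviation "I \<equiv> {0<..<x0}"

lemma sin_pos: "0 < x \<Longrightarrow> x \<le> x0 \<Longrightarrow> 0 < sin x"
  using x0 pi_gt_zero by (intro sin_gt_zero) linarith+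

lemma r_of_in_D: "0 < x \<Longrightarrow> x \<le> x0 \<Longrightarrow> r_of x \<in> D"
  using D r_of_antimono[of x x0] x0 by force

lemma F_pos: "0 < x \<Longrightarrow> x \<le> x0 \<Longrightarrow> 0 < F_of f x"
  using f_pos r_of_in_D by (simp add: F_of_def)

lemma a_pos: "0 < x \<Longrightarrow> x \<le> x0 \<Longrightarrow> 0 < a x"
  using F_pos[of x] sin_pos[of x] by (simp add: a_of_def)

lemma a_nonzero: "0 < x \<Longrightarrow> x \<le> x0 \<Longrightarrow> a x \<noteq> 0"
  using a_pos[of x] by simp

text \<open>Continuity at \<open>x0\<close> comes from \<open>f\<close>, since
  \<open>a_smooth\<close> covers only the open interval; the integral defining \<open>b\<close> ends
  at \<open>x0\<close>.\<close>

lemma a_continuous: "continuous_on {0<..x0} a"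
proof -
  have "continuous_on {0<..x0} r_of"
    by (rule DERIV_continuous_on)
       (use sin_pos in \<open>force intro!: has_field_derivative_at_within[OF DERIV_r_of]\<close>)
  then have "continuous_on {0<..x0} (\<lambda>x. f (r_of x))"
    by (rule continuous_on_compose2[OF f_cont]) (use r_of_in_D in auto)
  then show ?thesis
    unfolding a_of_def[abs_def] F_of_def by (intro continuous_intros)
qed

lemma b_deriv:
  assumes "x \<in> I"
  shows "(b has_real_derivative b x / a x) (at x)"
proof -
  \<comment> \<open>1/a is singular at 0, so the fundamental theorem is applied on a compact
    interval that starts at some positive point to the left of x.\<close>
  let ?c = "x / 2"
  have "continuous_on {?c..x0} (\<lambda>s. 1 / a s)"
    by (intro continuous_intros continuous_on_subset[OF a_continuous])
       (use a_nonzero assms in auto)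
  from integral_has_real_derivative'[OF this, of x]
  have "((\<lambda>x. integral {x..x0} (\<lambda>s. 1 / a s)) has_real_derivative - (1 / a x)) (at x)"
    using assms by (simp add: at_within_Icc_at)
  then show ?thesis
    unfolding b_of_def[abs_def] by (auto intro!: derivative_eq_intros)
qed

text \<open>The end point \<open>x0\<close> is included because the intermediate value argument for
  surjectivity runs up to \<open>b x0 = 1\<close>.\<close>

lemma b_continuous: "continuous_on {0<..x0} b"
proof -
  have "continuous (at x within {0<..x0}) b" if "0 < x" "x \<le> x0" for x
  proof (cases "x = x0")
    case True
    have "continuous_on {x0 / 2..x0} (\<lambda>s. 1 / a s)"
      by (intro continuous_intros continuous_on_subset[OF a_continuous])
         (use a_nonzero x0 in auto)
    from integral_has_real_derivative'[OF this, of x0] x0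
    have "continuous (at x0 within {x0 / 2..x0}) (\<lambda>x. integral {x..x0} (\<lambda>s. 1 / a s))"
      by (intro DERIV_continuous) auto
    then have "continuous (at x0 within {x0 / 2..x0}) b"
      unfolding b_of_def[abs_def] by (intro continuous_intros)
    moreover have "at x0 within {x0 / 2..x0} = at x0 within {0<..x0}"
      using x0 by (intro at_within_nhd[of _ "{x0 / 2<..}"]) auto
    ultimately show ?thesis using True by simp
  next
    case False
    then show ?thesis
      using that b_deriv[of x] by (auto intro: DERIV_continuous has_field_derivative_at_within)
  qed
  then show ?thesis by (simp add: continuous_on_eq_continuous_within)
qed

lemma b_pos: "0 < b x"
  by (simp add: b_of_def)

lemma b_x0: "b x0 = 1"
  by (simp add: b_of_def)

lemma b_strict_mono:
  assumes "0 < x" "x < y" "y \<le> x0"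
  shows "b x < b y"
proof (rule DERIV_pos_imp_increasing_open[OF assms(2)])
  show "\<exists>d. (b has_real_derivative d) (at z) \<and> 0 < d" if "x < z" "z < y" for z
    using b_deriv[of z] a_pos[of z] b_pos[of z] that assms
    by (intro exI[of _ "b z / a z"]) auto
  show "continuous_on {x..y} b"
    by (rule continuous_on_subset[OF b_continuous]) (use assms in auto)
qed

lemma a_deriv: "x \<in> I \<Longrightarrow> (a has_real_derivative deriv a x) (at x)"
  using smooth_on_differentiable[OF a_smooth]
  by (metis DERIV_deriv_iff_real_differentiable)

lemma a'_continuous: "continuous_on I (deriv a)"
proof -
  have "frechet_derivative a (at x) 1 = deriv a x" if "x \<in> I" for x
    using differentiable_imp_DERIV_frechet_derivative[OF smooth_on_differentiable[OF a_smooth that]]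
    by (metis DERIV_imp_deriv)
  moreover have "continuous_on I (\<lambda>x. frechet_derivative a (at x) 1)"
    using smooth_on_frechet_derivative[OF a_smooth, of 1]
    by (intro continuous_at_imp_continuous_on)
       (auto intro!: differentiable_imp_continuous_within smooth_on_differentiable)
  ultimately show ?thesis
    by (metis (no_types, lifting) continuous_on_cong)
qed

lemma eventually_in_I: "eventually (\<lambda>x. x \<in> I) (at_right 0)"
  using x0 by (intro eventually_at_rightI[of 0 x0]) auto

lemma a_asymp: "((\<lambda>x. a x / x) \<longlongrightarrow> 1) (at_right 0)"
proof -
  have "(\<lambda>x. (a x - x) / x) \<in> O[at_right 0](\<lambda>x. x ^ 2 / x)"
    by (intro landau_o.big.divide_right a_asym) (auto simp: eventually_at_filter)
  also have "(\<lambda>x::real. x ^ 2 / x) \<in> o[at_right 0](\<lambda>x. 1)"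
    by real_asymp
  finally have "((\<lambda>x. (a x - x) / x) \<longlongrightarrow> 0) (at_right 0)"
    by (auto dest: smalloD_tendsto)
  then have "((\<lambda>x. (a x - x) / x + 1) \<longlongrightarrow> 0 + 1) (at_right 0)"
    by (intro tendsto_intros)
  then show ?thesis
    by (auto elim!: Lim_transform_eventually simp: eventually_at_filter field_simps)
qed

lemma a_bigtheta: "a \<in> \<Theta>[at_right 0](\<lambda>x. x)"
  by (rule bigthetaI_tendsto[OF _ a_asymp]) (auto simp: eventually_at_filter)

definition h :: "real \<Rightarrow> real" where
  "h x = (sin x)\<^sup>2 / (a x * b x)"

lemma h_pos: "x \<in> I \<Longrightarrow> 0 < h x"
  unfolding h_def using a_pos[of x] b_pos[of x] sin_pos[of x] by simp

text \<open>The logarithm replaces \<open>b\<close>, known only as the exponential of an integral,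
  by its logarithmic derivative 1/a.\<close>

lemma ln_h_deriv:
  assumes "x \<in> I"
  shows "((\<lambda>x. ln (h x)) has_real_derivative (2 * a x * cot x - deriv a x - 1) / a x) (at x)"
proof -
  have "0 < a x" "0 < b x" "0 < sin x" using assms a_pos b_pos sin_pos by auto
  then show ?thesis
    unfolding h_def
    by (auto intro!: derivative_eq_intros a_deriv b_deriv assms
        simp: field_simps power2_eq_square cot_def)
qed

text \<open>Splits as 2 (a - x) cot x + 2 (x cot x - 1) - (a' - 1). The first term is O(x^2) O(1/x),
  the second is elementary, the third is the hypothesis on a'.\<close>

lemma radial_numerator_bigo:
  "(\<lambda>x. 2 * a x * cot x - deriv a x - 1) \<in> O[at_right 0](\<lambda>x. x)"
proof -
  have "(\<lambda>x::real. 2 * cot x) \<in> O[at_right 0](\<lambda>x. 1 / x)"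
    unfolding cot_def by real_asymp
  from landau_o.big.mult[OF a_asym this]
  have 1: "(\<lambda>x. (a x - x) * (2 * cot x)) \<in> O[at_right 0](\<lambda>x. x)"
    by (rule landau_o.big.ev_eq_trans1[where g = "\<lambda>x y. y"])
       (auto simp: eventually_at_filter power2_eq_square)
  have 2: "(\<lambda>x::real. 2 * (x * cot x - 1)) \<in> O[at_right 0](\<lambda>x. x)"
    unfolding cot_def by real_asymp
  have "(\<lambda>x. (a x - x) * (2 * cot x) + 2 * (x * cot x - 1) - (deriv a x - 1)) \<in> O[at_right 0](\<lambda>x. x)"
    by (intro sum_in_bigo 1 2 a'_asym)
  then show ?thesis by (simp add: algebra_simps)
qed

text \<open>The bounded derivative does not reveal the limit, but it makes ln h Lipschitz, hence
  uniformly continuous, and so extendable to 0. Passing through the logarithm gives a limit of the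
  form exp l, which is positive for free.\<close>

lemma h_tendsto:
  obtains l where "(h \<longlongrightarrow> exp l) (at_right 0)"
proof -
  let ?L' = "\<lambda>x. (2 * a x * cot x - deriv a x - 1) / a x"
  have "?L' \<in> O[at_right 0](\<lambda>x. x / x)"
  proof (rule landau_o.big.divide[OF _ _ radial_numerator_bigo])
    show "eventually (\<lambda>x. a x \<noteq> 0) (at_right 0)"
      using eventually_in_I by eventually_elim (use a_pos in force)
  qed (use a_bigtheta in \<open>auto simp: bigtheta_def bigomega_iff_bigo eventually_at_filter\<close>)
  then obtain C where C: "C > 0" "eventually (\<lambda>x. norm (?L' x) \<le> C * norm (x / x)) (at_right 0)"
    by (rule landau_o.bigE)
  then obtain d where d: "d > 0" "\<And>x. 0 < x \<Longrightarrow> x < d \<Longrightarrow> \<bar>?L' x\<bar> \<le> C"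
    by (auto simp: eventually_at_right_field)
  \<comment> \<open>The bound holds below \<open>d\<close>, the derivative formula only below
    \<open>x0\<close>.\<close>
  define \<delta> where "\<delta> = min d x0"
  have \<delta>: "0 < \<delta>" "\<delta> \<le> d" "\<delta> \<le> x0" using d x0 by (auto simp: \<delta>_def)
  have "C-lipschitz_on {0<..<\<delta>} (\<lambda>x. ln (h x))"
  proof (rule bounded_derivative_imp_lipschitz)
    fix x assume x: "x \<in> {0<..<\<delta>}"
    then have "x \<in> I" using \<delta> by auto
    then show "((\<lambda>x. ln (h x)) has_derivative (*) (?L' x)) (at x within {0<..<\<delta>})"
      using ln_h_deriv unfolding has_field_derivative_def by (blast intro: has_derivative_at_withinI)
    show "onorm ((*) (?L' x)) \<le> C"
      using d(2)[of x] x \<delta> by (intro onorm_mult_real_le) auto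
  qed (use C in auto)
  then have "uniformly_continuous_on {0<..<\<delta>} (\<lambda>x. ln (h x))"
    by (rule lipschitz_on_uniformly_continuous)
  then obtain l where l: "((\<lambda>x. ln (h x)) \<longlongrightarrow> l) (at 0 within {0<..<\<delta>})"
    by (rule uniformly_continuous_on_extension_at_closure[where x = 0]) (use \<delta> in auto)
  moreover have "at 0 within {0<..<\<delta>} = at_right 0"
    using \<delta> by (intro at_within_nhd[of _ "{..<\<delta>}"]) auto
  ultimately have "((\<lambda>x. exp (ln (h x))) \<longlongrightarrow> exp l) (at_right 0)"
    by (auto intro!: tendsto_intros)
  then have "(h \<longlongrightarrow> exp l) (at_right 0)"
    by (rule Lim_transform_eventually) (use eventually_in_I h_pos in \<open>auto elim!: eventually_mono\<close>)
  then show ?thesis by (rule that)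
qed

text \<open>The integral is not estimated: solving the definition of \<open>h\<close> for b gives b
  = sin^2 x / (a h), and every factor on the right has a known limit after division by the right
  power of x.\<close>

lemma b_bigtheta: "b \<in> \<Theta>[at_right 0](\<lambda>x. x)"
proof -
  obtain l where l: "(h \<longlongrightarrow> exp l) (at_right 0)" by (rule h_tendsto)
  have "((\<lambda>x::real. (sin x / x)\<^sup>2) \<longlongrightarrow> 1) (at_right 0)" by real_asymp
  then have "((\<lambda>x. (sin x / x)\<^sup>2 / (a x / x) / h x) \<longlongrightarrow> 1 / 1 / exp l) (at_right 0)"
    by (intro tendsto_intros a_asymp l) auto
  moreover have "eventually (\<lambda>x. (sin x / x)\<^sup>2 / (a x / x) / h x = b x / x) (at_right 0)"
    using eventually_in_I
  proof eventually_elim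
    case (elim x)
    then have "0 < a x" "0 < b x" "0 < sin x" using a_pos b_pos sin_pos by auto
    with elim show ?case by (simp add: h_def field_simps power2_eq_square)
  qed
  ultimately have "((\<lambda>x. b x / x) \<longlongrightarrow> 1 / 1 / exp l) (at_right 0)"
    by (rule Lim_transform_eventually)
  then show ?thesis
    by (intro bigthetaI_tendsto[where c = "1 / 1 / exp l"]) (auto simp: eventually_at_filter)
qed

lemma b_tendsto_0: "(b \<longlongrightarrow> 0) (at_right 0)"
proof -
  have "b \<in> O[at_right 0](\<lambda>x. x)" using b_bigtheta by auto
  also have "(\<lambda>x::real. x) \<in> o[at_right 0](\<lambda>x. 1)" by real_asymp
  finally show ?thesis by (auto dest: smalloD_tendsto)
qed

lemma b_bij: "bij_betw b I {0<..<1}"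
proof -
  have "inj_on b I"
    using b_strict_mono by (intro linorder_inj_onI) (auto, fastforce)
  moreover have "b ` I = {0<..<1}"
  proof safe
    fix x assume "x \<in> I"
    then show "b x \<in> {0<..<1}" using b_strict_mono[of x x0] b_pos b_x0 by auto
  next
    fix y :: real assume y: "y \<in> {0<..<1}"
    \<comment> \<open>The limit 0 supplies a point where b lies below y; the value 1 at
      \<open>x0\<close> lies above it.\<close>
    have "eventually (\<lambda>x. b x < y) (at_right 0)"
      using b_tendsto_0 y by (auto intro: order_tendstoD)
    with eventually_in_I have "eventually (\<lambda>x. x \<in> I \<and> b x < y) (at_right 0)"
      by eventually_elim auto
    then obtain x where x: "x \<in> I" "b x < y"
      using eventually_happens'[OF trivial_limit_at_right_real] by blast
    have "continuous_on {x..x0} b"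
      using x by (intro continuous_on_subset[OF b_continuous]) auto
    then obtain z where "x \<le> z" "z \<le> x0" "b z = y"
      using IVT'[of b x y x0] x y b_x0 by auto
    moreover from this have "z \<noteq> x0" using b_x0 y by auto
    ultimately show "y \<in> b ` I" using x by force
  qed
  ultimately show ?thesis by (simp add: bij_betw_def)
qed

section \<open>The inverse coordinate and functions of the radius\<close>

definition X :: "real \<Rightarrow> real" where
  "X = inv_into I b"

lemma X_b [simp]: "x \<in> I \<Longrightarrow> X (b x) = x"
  unfolding X_def using b_bij by (auto simp: bij_betw_def inv_into_f_f)

lemma b_X [simp]: "0 < \<rho> \<Longrightarrow> \<rho> < 1 \<Longrightarrow> b (X \<rho>) = \<rho>"
  unfolding X_def using b_bij by (auto simp: bij_betw_def intro!: f_inv_into_f)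

lemma X_in_I: "0 < \<rho> \<Longrightarrow> \<rho> < 1 \<Longrightarrow> X \<rho> \<in> I"
  unfolding X_def using b_bij by (metis bij_betw_def greaterThanLessThan_iff inv_into_into)

text \<open>Because \<open>b (X \<rho>) = \<rho>\<close>, the coordinate b drops out of the
  derivative. The resulting equation involves only a and \<rho>, which is what later yields
  smoothness.\<close>

lemma X_deriv:
  assumes "0 < \<rho>" "\<rho> < 1"
  shows "(X has_real_derivative a (X \<rho>) / \<rho>) (at \<rho>)"
proof -
  let ?x = "X \<rho>"
  have x: "?x \<in> I" using assms by (rule X_in_I)
  then have "b ?x / a ?x \<noteq> 0" using a_pos[of ?x] b_pos[of ?x] by simp
  then have inv: "(*) (b ?x / a ?x) \<circ> (*) (inverse (b ?x / a ?x)) = id"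
    by (auto simp: fun_eq_iff)
  have "(X has_derivative (*) (inverse (b ?x / a ?x))) (at (b ?x))"
    by (rule has_derivative_inverse_strong[of I _ b, OF _ x _ X_b _ inv])
       (use b_deriv[OF x] continuous_on_subset[OF b_continuous,
            OF greaterThanLessThan_subseteq_greaterThanAtMost_iff[THEN iffD2]]
         in \<open>auto simp: has_field_derivative_def\<close>)
  then have "(X has_real_derivative inverse (b ?x / a ?x)) (at (b ?x))"
    by (simp add: has_field_derivative_def)
  then show ?thesis using assms by simp
qed

lemma X_at_right_0: "filterlim X (at_right 0) (at_right 0)"
proof -
  have ev: "eventually (\<lambda>\<rho>. 0 < \<rho> \<and> \<rho> < 1) (at_right (0::real))"
    by (intro eventually_at_rightI[of 0 1]) auto
  have "eventually (\<lambda>\<rho>. X \<rho> < e) (at_right 0)" if "0 < e" for e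
  proof -
    \<comment> \<open>\<open>e\<close> may lie outside \<open>I\<close>; e' lies inside, and by
      monotonicity \<open>b e'\<close> is the threshold for \<rho>.\<close>
    define e' where "e' = min e (x0 / 2)"
    have e': "e' \<in> I" "e' \<le> e" using that x0 by (auto simp: e'_def)
    have "eventually (\<lambda>\<rho>. 0 < \<rho> \<and> \<rho> < b e') (at_right 0)"
      using b_pos[of e'] by (intro eventually_at_rightI[of 0 "b e'"]) auto
    with ev show ?thesis
    proof eventually_elim
      case (elim \<rho>)
      have "X \<rho> < e'"
      proof (rule ccontr)
        assume "\<not> X \<rho> < e'"
        then have "b e' \<le> b (X \<rho>)"
          using b_strict_mono[of e' "X \<rho>"] e' X_in_I[of \<rho>] elim by (cases "e' = X \<rho>") auto
        with elim show False by auto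
      qed
      then show ?case using e' by simp
    qed
  qed
  moreover have "eventually (\<lambda>\<rho>. 0 < X \<rho>) (at_right 0)"
    using ev by eventually_elim (use X_in_I in auto)
  ultimately have "(X \<longlongrightarrow> 0) (at_right 0)"
    by (intro order_tendstoI) (auto elim!: eventually_mono)
  with \<open>eventually (\<lambda>\<rho>. 0 < X \<rho>) (at_right 0)\<close> show ?thesis
    by (auto simp: filterlim_at elim!: eventually_mono)
qed

text \<open>Profiles are computed in x, while regularity on \<open>Mbar\<close> is measured in
  \<rho> = |y|. The value \<open>l\<close> is prescribed on the axis, where \<open>X\<close> carries
  no information.\<close>

definition radial :: "real \<Rightarrow> (real \<Rightarrow> real) \<Rightarrow> real \<Rightarrow> real" where
  "radial l u \<rho> = (if \<rho> = 0 then l else u (X \<rho>))"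

text \<open>The factor a/\<rho> is written as a/b at \<open>X \<rho>\<close>, so that the whole
  derivative is a function of x and asymptotic estimates in x apply to it.\<close>

lemma radial_deriv:
  assumes "\<And>x. x \<in> I \<Longrightarrow> (u has_real_derivative u' x) (at x)" and "0 < \<rho>" "\<rho> < 1"
  shows "(radial l u has_real_derivative u' (X \<rho>) * (a (X \<rho>) / b (X \<rho>))) (at \<rho>)"
proof -
  have "((\<lambda>\<rho>. u (X \<rho>)) has_real_derivative u' (X \<rho>) * (a (X \<rho>) / b (X \<rho>))) (at \<rho>)"
    using DERIV_chain2[OF assms(1) X_deriv] X_in_I assms(2,3) by simp
  then show ?thesis
    by (rule has_field_derivative_transform_within_open[of _ _ _ "{0<..<1}"])
       (use assms in \<open>auto simp: radial_def\<close>)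
qed

text \<open>The derivative is bounded near 0 by \<open>bigo\<close> and away from 0 by continuity on
  a compact interval, which stays below 1 because R < 1. The derivative bound is exported as well,
  since the condition on the differential of Omega needs it.\<close>

lemma radial_lipschitz:
  assumes du: "\<And>x. x \<in> I \<Longrightarrow> (u has_real_derivative u' x) (at x)"
    and cont: "continuous_on I u'"
    and lim: "(u \<longlongrightarrow> l) (at_right 0)"
    and bigo: "(\<lambda>x. u' x * (a x / b x)) \<in> O[at_right 0](\<lambda>_. 1)"
    and "R < 1"
  obtains C where "C-lipschitz_on {0..R} (radial l u)"
    "\<And>\<rho>. 0 < \<rho> \<Longrightarrow> \<rho> \<le> R \<Longrightarrow> \<bar>u' (X \<rho>) * (a (X \<rho>) / b (X \<rho>))\<bar> \<le> C"
\<comment> \<open>For \<open>R \<le> 0\<close> the interval is empty or a single point.\<close>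
proof (cases "0 < R")
  case False
  then have "0-lipschitz_on {0..R} (radial l u)"
    by (cases "R = 0") auto
  then show ?thesis by (rule that) (use False in auto)
next
  case R: True
  let ?g = "\<lambda>x. u' x * (a x / b x)"
  obtain c where "eventually (\<lambda>x. norm (?g x) \<le> c * norm (1::real)) (at_right 0)"
    using bigo by (rule landau_o.bigE)
  then have "eventually (\<lambda>\<rho>. \<bar>?g (X \<rho>)\<bar> \<le> c) (at_right 0)"
    using X_at_right_0 by (auto simp: filterlim_iff)
  then obtain d where d: "d > 0" "\<And>\<rho>. 0 < \<rho> \<Longrightarrow> \<rho> < d \<Longrightarrow> \<bar>?g (X \<rho>)\<bar> \<le> c"
    by (auto simp: eventually_at_right_field)
  have "continuous_on I ?g"
    using b_pos by (intro continuous_intros cont continuous_on_subset[OF a_continuous]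
        continuous_on_subset[OF b_continuous]) (auto simp: less_imp_neq[THEN not_sym])
  moreover have "continuous_on {0<..<1} X"
    by (rule DERIV_continuous_on) (auto intro: has_field_derivative_at_within X_deriv)
  ultimately have "continuous_on {0<..<1} (\<lambda>\<rho>. ?g (X \<rho>))"
    by (rule continuous_on_compose2) (use X_in_I in auto)
  then have "continuous_on {d / 2..R} (\<lambda>\<rho>. ?g (X \<rho>))"
    using d \<open>R < 1\<close> by (elim continuous_on_subset) auto
  then have "bounded ((\<lambda>\<rho>. ?g (X \<rho>)) ` {d / 2..R})"
    by (intro compact_imp_bounded compact_continuous_image) auto
  then obtain c' where "\<forall>y\<in>(\<lambda>\<rho>. ?g (X \<rho>)) ` {d / 2..R}. norm y \<le> c'"
    unfolding bounded_iff by blast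
  then have c': "\<bar>?g (X \<rho>)\<bar> \<le> c'" if "d / 2 \<le> \<rho>" "\<rho> \<le> R" for \<rho>
    using that unfolding ball_simps real_norm_def by simp
  \<comment> \<open>The maximum with 0 makes the constant admissible as a Lipschitz constant, which
    must be nonnegative.\<close>
  define C where "C = max 0 (max c c')"
  have C: "\<bar>?g (X \<rho>)\<bar> \<le> C" if "0 < \<rho>" "\<rho> \<le> R" for \<rho>
    using d(2)[of \<rho>] c'[of \<rho>] d(1) that unfolding C_def by (cases "\<rho> < d") (auto simp: le_max_iff_disj)
  \<comment> \<open>No derivative is available at 0, so the bound is used on the open interval and
    carried to the closure by continuity.\<close>
  have "C-lipschitz_on {0<..<R} (radial l u)"
  proof (rule bounded_derivative_imp_lipschitz)
    fix \<rho> assume \<rho>: "\<rho> \<in> {0<..<R}"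
    then show "(radial l u has_derivative (*) (?g (X \<rho>))) (at \<rho> within {0<..<R})"
      using radial_deriv[of u u' \<rho> l] du \<open>R < 1\<close> unfolding has_field_derivative_def
      by (auto intro: has_derivative_at_withinI)
    show "onorm ((*) (?g (X \<rho>))) \<le> C"
      using C \<rho> by (intro onorm_mult_real_le) simp
  qed (auto simp: C_def)
  moreover have "continuous_on {0..R} (radial l u)"
  proof -
    have "continuous (at \<rho> within {0..R}) (radial l u)" if "0 \<le> \<rho>" "\<rho> \<le> R" for \<rho>
    proof (cases "\<rho> = 0")
      case True
      have "((\<lambda>\<rho>. u (X \<rho>)) \<longlongrightarrow> l) (at_right 0)"
        using lim X_at_right_0 by (rule filterlim_compose)
      then have "(radial l u \<longlongrightarrow> l) (at_right 0)"
        by (rule Lim_transform_eventually) (auto simp: radial_def eventually_at_filter)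
      then have "(radial l u \<longlongrightarrow> l) (at 0 within {0..R})"
        using R by (simp add: at_within_Icc_at_right)
      then show ?thesis using True by (simp add: continuous_within radial_def)
    next
      case False
      then show ?thesis
        using that \<open>R < 1\<close> radial_deriv[of u u' \<rho> l, OF du]
        by (auto intro: DERIV_continuous has_field_derivative_at_within)
    qed
    then show ?thesis by (simp add: continuous_on_eq_continuous_within)
  qed
  ultimately have "C-lipschitz_on {0..R} (radial l u)"
    using lipschitz_on_closure[of C "{0<..<R}" "radial l u"] R by simp
  then show ?thesis using C by (rule that)
qed

end

section \<open>The ambient space Mbar and its axis\<close>

lemma lorentzian_form_conformal:
  fixes c :: real
  assumes "0 < c"
  shows "lorentzian_form (\<lambda>u v :: real \<times> (real^'n). - (fst u * fst v) + c * (snd u \<bullet> snd v))"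
  unfolding lorentzian_form_def
proof (intro exI conjI allI)
  let ?L = "\<lambda>u :: real \<times> (real^'n). (fst u, (1 / sqrt c) *\<^sub>R snd u)"
  show "linear ?L"
    by (intro linearI) (auto simp: algebra_simps)
  show "bij ?L"
    by (rule bij_betwI[of _ _ _ "\<lambda>u. (fst u, sqrt c *\<^sub>R snd u)"]) (use assms in auto)
  show "- (fst (?L u) * fst (?L v)) + c * (snd (?L u) \<bullet> snd (?L v)) =
      - (fst u * fst v) + snd u \<bullet> snd v" for u v
    using assms by (simp add: field_simps)
qed

lemma locally_lipschitz_on_imp_continuous_on:
  assumes "locally_lipschitz_on S g"
  shows "continuous_on S g"
  unfolding continuous_on_eq_continuous_within
proof
  fix p assume p: "p \<in> S"
  then obtain e C where e: "e > 0" "C-lipschitz_on (ball p e \<inter> S) g"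
    using assms by (auto simp: locally_lipschitz_on_def)
  then have "continuous (at p within ball p e \<inter> S) g"
    using p lipschitz_on_continuous_on[OF e(2)] by (simp add: continuous_on_eq_continuous_within)
  moreover have "at p within ball p e \<inter> S = at p within S"
    using e by (intro at_within_nhd[of _ "ball p e"]) auto
  ultimately show "continuous (at p within S) g" by simp
qed

text \<open>Serves the metric components: for fixed vectors u and v they are affine functions of the
  conformal factor.\<close>

lemma locally_lipschitz_on_affine:
  fixes g :: "'a::metric_space \<Rightarrow> real"
  assumes "locally_lipschitz_on S g"
  shows "locally_lipschitz_on S (\<lambda>q. c + g q * d)"
  unfolding locally_lipschitz_on_def
proof
  fix p assume "p \<in> S"
  then obtain e C where e: "e > 0" "C-lipschitz_on (ball p e \<inter> S) g"
    using assms by (auto simp: locally_lipschitz_on_def)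
  from lipschitz_on_add[OF lipschitz_on_constant[of _ c] lipschitz_on_cmult_real[OF e(2), of d]] e(1)
  show "\<exists>e>0. \<exists>C. C-lipschitz_on (ball p e \<inter> S) (\<lambda>q. c + g q * d)"
    by (auto simp: mult.commute)
qed

text \<open>The norm is 1-Lipschitz through the origin too, so points on and off the axis need no
  separate treatment.\<close>

lemma locally_lipschitz_on_Mbar_radial:
  fixes U :: "real \<Rightarrow> real"
  assumes "\<And>R. R < 1 \<Longrightarrow> \<exists>C. C-lipschitz_on {0..R} U"
  shows "locally_lipschitz_on Mbar (\<lambda>q :: real \<times> (real^'n). U (norm (snd q)))"
  unfolding locally_lipschitz_on_def
proof
  fix p :: "real \<times> (real^'n)" assume p: "p \<in> Mbar"
  \<comment> \<open>Midway between |y| at p and 1; a ball of radius R - |y| around p then stays in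
    |y| \<le> R.\<close>
  define R where "R = (1 + norm (snd p)) / 2"
  have R: "norm (snd p) < R" "R < 1" using p by (auto simp: Mbar_def R_def)
  then obtain C where C: "C-lipschitz_on {0..R} U" using assms by blast
  have norm_diff: "\<bar>norm (snd q) - norm (snd q')\<bar> \<le> dist q q'" for q q' :: "real \<times> (real^'n)"
    using norm_triangle_ineq3[of "snd q" "snd q'"] dist_snd_le[of q q'] by (simp add: dist_norm)
  have "norm (snd q) \<in> {0..R}" if "q \<in> ball p (R - norm (snd p)) \<inter> Mbar" for q
    using norm_diff[of p q] that by auto
  moreover have "1-lipschitz_on (ball p (R - norm (snd p)) \<inter> Mbar) (\<lambda>q. norm (snd q))"
    using norm_diff by (auto simp: lipschitz_on_def dist_real_def)
  ultimately have "(C * 1)-lipschitz_on (ball p (R - norm (snd p)) \<inter> Mbar) (\<lambda>q. U (norm (snd q)))"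
    using C by (intro lipschitz_on_compose2) (auto intro: lipschitz_on_subset)
  then show "\<exists>e>0. \<exists>C. C-lipschitz_on (ball p e \<inter> Mbar) (\<lambda>q. U (norm (snd q)))"
    using R by (intro exI[of _ "R - norm (snd p)"]) auto
qed

text \<open>A quadratic form has a linear derivative, so a single differentiation reduces to the
  bounded linear case.\<close>

lemma smooth_on_inner_snd:
  fixes S :: "(real \<times> (real^'n)) set"
  assumes "open S"
  shows "smooth_on S (\<lambda>q. snd q \<bullet> snd q)"
proof -
  have "ndiff n S (\<lambda>q. snd q \<bullet> snd q)" for n
  proof (cases n)
    case (Suc m)
    have "ndiff (Suc m) S (\<lambda>q. snd q \<bullet> snd q)"
    proof (rule ndiff_SucI[OF assms])
      show "((\<lambda>q. snd q \<bullet> snd q) has_derivative (\<lambda>v. 2 * (snd q \<bullet> snd v))) (at q)" for q :: "real \<times> (real^'n)"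
        by (auto intro!: derivative_eq_intros simp: inner_commute)
      show "ndiff m S (\<lambda>q. 2 * (snd q \<bullet> snd v))" for v
        by (intro ndiff_bounded_linear assms bounded_linear_const_mult
            bounded_linear_compose[OF bounded_linear_inner_left bounded_linear_snd])
    qed
    with Suc show ?thesis by simp
  qed auto
  then show ?thesis by (simp add: smooth_on_iff_ndiff)
qed

lemma open_Mbar_minus_J: "open (Mbar - J_set :: (real \<times> (real^'n)) set)"
proof -
  have "Mbar - J_set = UNIV \<times> (ball 0 1 - {0 :: real^'n})"
    by (auto simp: Mbar_def J_set_def)
  then show ?thesis by (simp add: open_Times open_delete)
qed

lemma Mbar_inter_frontier: "Mbar \<inter> frontier (Mbar - J_set :: (real \<times> (real^'n)) set) = J_set"
proof -
  have "(t, 0) \<in> closure (Mbar - J_set :: (real \<times> (real^'n)) set)" for t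
    unfolding closure_approachable
  proof (intro allI impI)
    fix e :: real assume e: "0 < e"
    \<comment> \<open>Any nonzero vector shorter than both e and 1 would do; the coordinate
      direction is arbitrary.\<close>
    define w :: "real^'n" where "w = (min e 1 / 2) *\<^sub>R axis undefined 1"
    have w: "norm w = min e 1 / 2" using e by (simp add: w_def)
    then have "w \<noteq> 0" using e by auto
    then have "(t, w) \<in> Mbar - J_set" "dist (t, w) (t, 0) < e"
      using e w by (auto simp: Mbar_def J_set_def dist_Pair_Pair)
    then show "\<exists>y\<in>Mbar - J_set. dist y (t, 0 :: real^'n) < e" by blast
  qed
  then show ?thesis
    using interior_open[OF open_Mbar_minus_J[where 'n = 'n]]
    by (auto simp: frontier_def Mbar_def J_set_def)
qed

text \<open>A limit would force the first component, t itself, to converge. This excludes end points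
  of the curve and is how inextendibility is expressed.\<close>

lemma axis_not_tendsto:
  fixes q :: "real \<times> (real^'n)"
  shows "\<not> ((\<lambda>t::real. (t, 0)) \<longlongrightarrow> q) at_top" "\<not> ((\<lambda>t::real. (t, 0)) \<longlongrightarrow> q) at_bot"
proof -
  have "((\<lambda>t. t) \<longlongrightarrow> fst q) F" if "((\<lambda>t::real. (t, 0)) \<longlongrightarrow> q) F" for F
    using tendsto_fst[OF that] by simp
  then show "\<not> ((\<lambda>t::real. (t, 0)) \<longlongrightarrow> q) at_top" "\<not> ((\<lambda>t::real. (t, 0)) \<longlongrightarrow> q) at_bot"
    using not_tendsto_and_filterlim_at_infinity[OF _ _ filterlim_at_top_imp_at_infinity[OF filterlim_ident]]
      not_tendsto_and_filterlim_at_infinity[OF _ _ filterlim_at_bot_imp_at_infinity[OF filterlim_ident]]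
    by force+
qed

lemma smooth_map_on_axis: "smooth_map_on UNIV (\<lambda>t::real. (t, 0::real^'n))"
  unfolding smooth_map_on_def
proof
  fix u :: "real \<times> (real^'n)"
  have "smooth_on UNIV (\<lambda>t. t * fst u)"
    by (rule smooth_on_bounded_linear) (auto intro: bounded_linear_mult_left)
  then show "smooth_on UNIV (\<lambda>t. (t, 0) \<bullet> u)"
    by (simp add: inner_prod_def)
qed

section \<open>The conformal factor and Omega across the axis\<close>

context radial_profile
begin

text \<open>The coefficient of |dy|^2 in gbar. \<open>Lim\<close> names the limit whose existence
  \<open>h_tendsto\<close> asserts, so that it can serve as the value on the axis.\<close>

definition conf :: "real \<Rightarrow> real" where
  "conf = radial ((Lim (at_right 0) h)\<^sup>2) (\<lambda>x. (h x)\<^sup>2)"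

definition omega :: "real \<Rightarrow> real" where
  "omega = radial 0 (\<lambda>x. (sin x)\<^sup>2 / a x)"

lemma h_tendsto_Lim: "(h \<longlongrightarrow> Lim (at_right 0) h) (at_right 0)" "0 < Lim (at_right 0) h"
  using h_tendsto tendsto_Lim[OF trivial_limit_at_right_real] by (metis exp_gt_zero)+

lemma conf_b: "x \<in> I \<Longrightarrow> conf (b x) = (h x)\<^sup>2"
  using b_pos[of x] by (simp add: conf_def radial_def)

lemma omega_b: "x \<in> I \<Longrightarrow> omega (b x) = (sin x)\<^sup>2 / a x"
  using b_pos[of x] by (simp add: omega_def radial_def)

lemma conf_pos: "0 \<le> \<rho> \<Longrightarrow> \<rho> < 1 \<Longrightarrow> 0 < conf \<rho>"
  using h_tendsto_Lim(2) h_pos[OF X_in_I[of \<rho>]] by (auto simp: conf_def radial_def)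

lemma omega_pos: "0 < \<rho> \<Longrightarrow> \<rho> < 1 \<Longrightarrow> 0 < omega \<rho>"
  using X_in_I[of \<rho>] a_pos[of "X \<rho>"] sin_pos[of "X \<rho>"] by (auto simp: omega_def radial_def)

text \<open>With d/d|y| = (a/b) d/dx, a radial derivative is bounded as soon as u' a is
  O(x).\<close>

lemma bigo_divide_b:
  assumes "g \<in> O[at_right 0](\<lambda>x. x)"
  shows "(\<lambda>x. g x / b x) \<in> O[at_right 0](\<lambda>_. 1)"
proof -
  have "(\<lambda>x. g x / b x) \<in> O[at_right 0](\<lambda>x. x / x)"
    using b_bigtheta b_pos
    by (intro landau_o.big.divide assms)
       (auto simp: bigtheta_def bigomega_iff_bigo eventually_at_filter less_imp_neq[THEN not_sym])
  then show ?thesis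
    by (rule landau_o.big.ev_eq_trans1[where g = "\<lambda>x y. y"]) (auto simp: eventually_at_filter)
qed

text \<open>The singular factor 1/a of the logarithmic derivative cancels against a/b, which leaves
  2 h^2 N / b with h^2 convergent and N = O(x).\<close>

lemma conf_lipschitz: "R < 1 \<Longrightarrow> \<exists>C. C-lipschitz_on {0..R} conf"
proof -
  assume "R < 1"
  let ?N = "\<lambda>x. 2 * a x * cot x - deriv a x - 1"
  let ?u' = "\<lambda>x. 2 * (h x)\<^sup>2 * (?N x / a x)"
  have "((\<lambda>x. (h x)\<^sup>2) has_real_derivative ?u' x) (at x)" if x: "x \<in> I" for x
  proof -
    \<comment> \<open>Written as an exponential, h^2 inherits its derivative from
      \<open>ln_h_deriv\<close>.\<close>
    have "((\<lambda>x. exp (2 * ln (h x))) has_real_derivative exp (2 * ln (h x)) * (2 * (?N x / a x))) (at x)"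
      by (intro derivative_intros DERIV_cmult ln_h_deriv x DERIV_fun_exp)
    moreover have exp: "exp (2 * ln (h y)) = (h y)\<^sup>2" if "y \<in> I" for y
      using h_pos[OF that] by (simp add: exp_double)
    ultimately have "((\<lambda>x. (h x)\<^sup>2) has_real_derivative exp (2 * ln (h x)) * (2 * (?N x / a x))) (at x)"
      using x by (auto elim!: has_field_derivative_transform_within_open[where S = I])
    then show ?thesis
      by (rule DERIV_cong) (simp add: exp[OF x])
  qed
  moreover have "continuous_on I ?u'"
    unfolding h_def cot_def
    using a_nonzero b_pos sin_pos
    by (intro continuous_intros a'_continuous continuous_on_subset[OF a_continuous]
        continuous_on_subset[OF b_continuous]) (force simp: less_le)+
  moreover have "((\<lambda>x. (h x)\<^sup>2) \<longlongrightarrow> (Lim (at_right 0) h)\<^sup>2) (at_right 0)"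
    by (intro tendsto_intros h_tendsto_Lim)
  moreover have "(\<lambda>x. ?u' x * (a x / b x)) \<in> O[at_right 0](\<lambda>_. 1)"
  proof -
    have "(\<lambda>x. 2 * (h x)\<^sup>2) \<in> O[at_right 0](\<lambda>_. 1)"
      by (rule bigoI_tendsto[of _ _ "2 * (Lim (at_right 0) h)\<^sup>2"])
         (auto intro!: tendsto_intros h_tendsto_Lim)
    from landau_o.big.mult[OF this bigo_divide_b[OF radial_numerator_bigo]]
    have "(\<lambda>x. 2 * (h x)\<^sup>2 * (?N x / b x)) \<in> O[at_right 0](\<lambda>_. 1)"
      by simp
    then show ?thesis
      by (rule landau_o.big.ev_eq_trans2[where g = "\<lambda>x y. y", rotated])
         (use eventually_in_I in \<open>eventually_elim, use a_nonzero in auto\<close>)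
  qed
  ultimately show ?thesis
    unfolding conf_def using \<open>R < 1\<close> by (rule radial_lipschitz) blast+
qed

text \<open>Here u' a = 2 sin x cos x - Omega a', where Omega = O(x) and a' is bounded. Both terms
  are O(x) separately, so no cancellation is involved.\<close>

lemma omega_lipschitz_deriv_bound:
  assumes "R < 1"
  obtains C where "C-lipschitz_on {0..R} omega"
    "\<And>\<rho>. 0 < \<rho> \<Longrightarrow> \<rho> \<le> R \<Longrightarrow> \<exists>d. (omega has_real_derivative d) (at \<rho>) \<and> \<bar>d\<bar> \<le> C"
proof -
  let ?u' = "\<lambda>x. (2 * sin x * cos x - (sin x)\<^sup>2 / a x * deriv a x) / a x"
  have du: "((\<lambda>x. (sin x)\<^sup>2 / a x) has_real_derivative ?u' x) (at x)" if x: "x \<in> I" for x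
    using a_nonzero[of x] x
    by (auto intro!: derivative_eq_intros a_deriv simp: field_simps power2_eq_square)
  have cont: "continuous_on I ?u'"
    using a_nonzero
    by (intro continuous_intros a'_continuous continuous_on_subset[OF a_continuous]) auto
  have inv_a: "(\<lambda>x. inverse (a x)) \<in> O[at_right 0](\<lambda>x. inverse x)"
    by (rule bigthetaD1) (simp add: a_bigtheta)
  have "(\<lambda>x::real. (sin x)\<^sup>2) \<in> O[at_right 0](\<lambda>x. x ^ 2)" by real_asymp
  from landau_o.big.mult[OF this inv_a]
  have omega_bigo: "(\<lambda>x. (sin x)\<^sup>2 / a x) \<in> O[at_right 0](\<lambda>x. x)"
    by (auto elim!: landau_o.big.ev_eq_trans1[where g = "\<lambda>x y. y"]
        simp: divide_inverse eventually_at_filter power2_eq_square)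
  also have "(\<lambda>x::real. x) \<in> o[at_right 0](\<lambda>_. 1)" by real_asymp
  finally have lim: "((\<lambda>x. (sin x)\<^sup>2 / a x) \<longlongrightarrow> 0) (at_right 0)"
    by (auto dest: smalloD_tendsto)
  have "(\<lambda>x::real. x) \<in> O[at_right 0](\<lambda>_. 1)" "(\<lambda>_. 1::real) \<in> O[at_right 0](\<lambda>_::real. 1)" by real_asymp+
  then have "(\<lambda>x. (deriv a x - 1) + 1) \<in> O[at_right 0](\<lambda>_. 1)"
    by (intro sum_in_bigo landau_o.big_trans[OF a'_asym])
  then have "(\<lambda>x. deriv a x) \<in> O[at_right 0](\<lambda>_. 1)" by simp
  from landau_o.big.mult[OF omega_bigo this]
  have 1: "(\<lambda>x. (sin x)\<^sup>2 / a x * deriv a x) \<in> O[at_right 0](\<lambda>x. x)" by simp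
  have "(\<lambda>x::real. 2 * sin x * cos x) \<in> O[at_right 0](\<lambda>x. x)" by real_asymp
  from bigo_divide_b[OF sum_in_bigo(2)[OF this 1]]
  have "(\<lambda>x. ?u' x * (a x / b x)) \<in> O[at_right 0](\<lambda>_. 1)"
    by (rule landau_o.big.ev_eq_trans2[where g = "\<lambda>x y. y", rotated])
       (use eventually_in_I in \<open>eventually_elim, use a_nonzero in auto\<close>)
  from radial_lipschitz[OF du cont lim this assms] obtain C
    where C: "C-lipschitz_on {0..R} omega"
      "\<And>\<rho>. 0 < \<rho> \<Longrightarrow> \<rho> \<le> R \<Longrightarrow> \<bar>?u' (X \<rho>) * (a (X \<rho>) / b (X \<rho>))\<bar> \<le> C"
    unfolding omega_def by blast
  show ?thesis
  proof (rule that[OF C(1)])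
    fix \<rho> :: real assume \<rho>: "0 < \<rho>" "\<rho> \<le> R"
    then have "(omega has_real_derivative ?u' (X \<rho>) * (a (X \<rho>) / b (X \<rho>))) (at \<rho>)"
      unfolding omega_def using assms by (intro radial_deriv du) auto
    with C(2)[OF \<rho>] show "\<exists>d. (omega has_real_derivative d) (at \<rho>) \<and> \<bar>d\<bar> \<le> C" by blast
  qed
qed

text \<open>Off the axis the gradient of |y| is a unit vector, so the operator norm is at most the
  radial derivative. The radius 1/2 stands for any number below 1.\<close>

lemma omega_norm_derivative_bound:
  obtains C where "\<And>q :: real \<times> (real^'n). 0 < norm (snd q) \<Longrightarrow> norm (snd q) < 1 / 2 \<Longrightarrow>
    \<exists>L. ((\<lambda>q. omega (norm (snd q))) has_derivative L) (at q) \<and> onorm L \<le> C"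
proof -
  obtain C where C: "\<And>\<rho>. 0 < \<rho> \<Longrightarrow> \<rho> \<le> 1 / 2 \<Longrightarrow> \<exists>d. (omega has_real_derivative d) (at \<rho>) \<and> \<bar>d\<bar> \<le> C"
    by (rule omega_lipschitz_deriv_bound[of "1 / 2"]) auto
  show ?thesis
  proof (rule that)
    fix q :: "real \<times> (real^'n)" assume q: "0 < norm (snd q)" "norm (snd q) < 1 / 2"
    then obtain d where d: "(omega has_real_derivative d) (at (norm (snd q)))" "\<bar>d\<bar> \<le> C"
      using C[of "norm (snd q)"] by auto
    have "((\<lambda>q :: real \<times> (real^'n). norm (snd q)) has_derivative (\<lambda>v. snd v \<bullet> sgn (snd q))) (at q)"
      by (rule has_derivative_compose[OF bounded_linear_imp_has_derivative[OF bounded_linear_snd]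
            has_derivative_norm])
         (use q in simp)
    from has_derivative_compose[OF this d(1)[unfolded has_field_derivative_def]]
    have "((\<lambda>q. omega (norm (snd q))) has_derivative (\<lambda>v. d * (snd v \<bullet> sgn (snd q)))) (at q)" .
    moreover have "onorm (\<lambda>v :: real \<times> (real^'n). d * (snd v \<bullet> sgn (snd q))) \<le> C"
    proof (rule onorm_bound)
      fix v :: "real \<times> (real^'n)"
      have "\<bar>snd v \<bullet> sgn (snd q)\<bar> \<le> norm (snd v) * norm (sgn (snd q))"
        by (rule Cauchy_Schwarz_ineq2)
      also have "\<dots> \<le> norm v" using q norm_snd_le[of "snd v" "fst v"] by (auto simp: norm_sgn)
      finally show "norm (d * (snd v \<bullet> sgn (snd q))) \<le> C * norm v"
        using d(2) by (auto simp: abs_mult intro!: mult_mono)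
    qed (use d(2) in auto)
    ultimately show "\<exists>L. ((\<lambda>q. omega (norm (snd q))) has_derivative L) (at q) \<and> onorm L \<le> C"
      by blast
  qed
qed

lemma omega_norm_smooth: "smooth_on (Mbar - J_set) (\<lambda>q :: real \<times> (real^'n). omega (norm (snd q)))"
proof -
  have "smooth_on I (\<lambda>x. sin x * sin x * inverse (a x))"
    using a_nonzero by (intro smooth_on_mult smooth_on_sin smooth_on_inverse a_smooth) auto
  then have "smooth_on {0<..<1} (\<lambda>s. sin (X (sqrt s)) * sin (X (sqrt s)) * inverse (a (X (sqrt s))))"
  \<comment> \<open>With s = |y|^2, the equation X' = a(X)/\<rho> and d(sqrt s)/ds = 1/(2 sqrt s)
    combine to Y' = a(Y)/(2 s), free of square roots.\<close>
  proof (rule smooth_on_ode_solution[where Y = "\<lambda>s. X (sqrt s)" and T = I and a = a, rotated -1])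
    fix s :: real assume s: "s \<in> {0<..<1}"
    then have "((\<lambda>s. X (sqrt s)) has_real_derivative a (X (sqrt s)) / sqrt s * (inverse (sqrt s) / 2)) (at s)"
      by (intro DERIV_chain2[OF X_deriv DERIV_real_sqrt]) auto
    then show "((\<lambda>s. X (sqrt s)) has_real_derivative a (X (sqrt s)) / (2 * s)) (at s)"
      by (rule DERIV_cong) (use s in \<open>simp add: field_simps flip: power2_eq_square\<close>)
  qed (use X_in_I a_smooth in auto)
  then have "smooth_on (Mbar - J_set) (\<lambda>q :: real \<times> (real^'n).
      sin (X (sqrt (snd q \<bullet> snd q))) * sin (X (sqrt (snd q \<bullet> snd q))) *
      inverse (a (X (sqrt (snd q \<bullet> snd q)))))"
    by (intro smooth_on_compose[OF open_Mbar_minus_J _ _ smooth_on_inner_snd[OF open_Mbar_minus_J],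
          where T = "{0<..<1}"])
       (auto simp: Mbar_def J_set_def dot_square_norm power_less_one_iff)
  then show ?thesis
    by (rule smooth_on_cong[OF open_Mbar_minus_J, rotated])
       (auto simp: omega_def radial_def J_set_def norm_eq_sqrt_inner power2_eq_square divide_inverse)
qed

section \<open>Polar coordinates and the metric identities\<close>

text \<open>Solving the definition of a for F makes F, Omega and G rational in a and sin x, and the
  metric identities become algebra.\<close>

lemma F_eq: "x \<in> I \<Longrightarrow> F_of f x = (a x / (sin x)\<^sup>2)\<^sup>2"
  using F_pos[of x] sin_pos[of x] by (simp add: a_of_def power_mult_distrib)

lemma Omega_eq: "x \<in> I \<Longrightarrow> Omega_of f x = (sin x)\<^sup>2 / a x"
  using F_pos[of x] sin_pos[of x]
  by (simp add: Omega_of_def a_of_def powr_minus powr_half_sqrt field_simps)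

lemma G_eq: "x \<in> I \<Longrightarrow> G_of f x = (sin x)\<^sup>2 / (a x)\<^sup>2"
  using a_pos[of x] sin_pos[of x]
  by (simp add: G_of_def F_eq field_simps eval_nat_numeral)

lemma Phi_inj: "inj_on (Phi f x0) (M_coords x0 :: (real \<times> real \<times> (real^'n)) set)"
proof (rule inj_onI, clarsimp simp: M_coords_def Phi_def)
  fix x y and w w' :: "real^'n"
  assume x: "0 < x" "x < x0" "0 < y" "y < x0" and w: "norm w = 1" "norm w' = 1"
    and eq: "b x *\<^sub>R w = b y *\<^sub>R w'"
  from arg_cong[OF eq, of norm] have "b x = b y"
    using w b_pos[of x] b_pos[of y] by simp
  with x have "x = y" using b_bij by (auto simp: bij_betw_def inj_on_def)
  with eq b_pos[of x] show "x = y \<and> w = w'" by simp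
qed

lemma Phi_image: "Phi f x0 ` (M_coords x0 :: (real \<times> real \<times> (real^'n)) set) = Mbar - J_set"
proof (intro equalityI subsetI)
  fix q assume "q \<in> Phi f x0 ` (M_coords x0 :: (real \<times> real \<times> (real^'n)) set)"
  then obtain t x w where q: "q = Phi f x0 (t, x, w)" "(t, x, w) \<in> M_coords x0" by auto
  then have "x \<in> I" "norm w = 1" by (auto simp: M_coords_def)
  moreover from this have "b x \<in> {0<..<1}" using b_bij by (auto simp: bij_betw_def)
  ultimately show "q \<in> Mbar - J_set"
    unfolding q by (auto simp: Phi_def Mbar_def J_set_def)
next
  fix q :: "real \<times> (real^'n)" assume q: "q \<in> Mbar - J_set"
  obtain t y where ty: "q = (t, y)" by (cases q)
  with q have y: "0 < norm y" "norm y < 1" by (auto simp: Mbar_def J_set_def)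
  then have "Phi f x0 (t, X (norm y), sgn y) = q"
    by (simp add: Phi_def sgn_div_norm ty)
  moreover have "(t, X (norm y), sgn y) \<in> M_coords x0"
    using X_in_I[OF y] y by (auto simp: M_coords_def norm_sgn)
  ultimately show "q \<in> Phi f x0 ` M_coords x0" by (metis imageI)
qed

lemma snd_Phi: "snd (Phi f x0 (t, x, w)) = b x *\<^sub>R w"
  by (simp add: Phi_def)

text \<open>The vectors are images under the differential of \<open>Phi\<close>: a radial part along
  w and a tangential part orthogonal to w. As b' = b/a, both parts carry the factor (b/a)^2, and h
  b/a = G.\<close>

lemma pullback_metric:
  fixes w v1 v2 :: "real^'n"
  assumes "(t, x, w) \<in> M_coords x0" "(b has_real_derivative db) (at x)" "w \<bullet> v1 = 0" "w \<bullet> v2 = 0"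
  shows "conf (norm (snd (Phi f x0 (t, x, w)))) *
      (((db * \<xi>1) *\<^sub>R w + b x *\<^sub>R v1) \<bullet> ((db * \<xi>2) *\<^sub>R w + b x *\<^sub>R v2)) =
    (G_of f x)\<^sup>2 * (\<xi>1 * \<xi>2 + (a x)\<^sup>2 * (v1 \<bullet> v2))"
proof -
  have x: "x \<in> I" and w: "norm w = 1" using assms(1) by (auto simp: M_coords_def)
  have db: "db = b x / a x" using DERIV_unique[OF assms(2) b_deriv[OF x]] .
  have pos: "0 < a x" "0 < b x" "0 < sin x" using x a_pos b_pos sin_pos by auto
  have "w \<bullet> w = 1" using w by (simp add: dot_square_norm)
  then have "((db * \<xi>1) *\<^sub>R w + b x *\<^sub>R v1) \<bullet> ((db * \<xi>2) *\<^sub>R w + b x *\<^sub>R v2) =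
      (b x / a x)\<^sup>2 * (\<xi>1 * \<xi>2 + (a x)\<^sup>2 * (v1 \<bullet> v2))"
    using assms(3,4) pos
    by (simp add: inner_add inner_commute[of v1 w] db field_simps power2_eq_square)
  moreover have "(h x)\<^sup>2 * (b x / a x)\<^sup>2 = (G_of f x)\<^sup>2"
    using pos by (simp add: G_eq[OF x] h_def field_simps power2_eq_square)
  ultimately show ?thesis
    using w pos by (simp add: snd_Phi conf_b[OF x] flip: mult.assoc)
qed

text \<open>Compares three coefficients: Omega^2 F = 1, Omega^2 (dr/dx)^2 / F = G^2 and Omega^2 =
  G^2 a^2. Here \<open>V\<close> stands for the inner product of the sphere components.\<close>

lemma conformal_identity:
  assumes "x \<in> I" "(r_of has_real_derivative dr) (at x)"
  shows "- (\<tau>1 * \<tau>2) + (G_of f x)\<^sup>2 * (\<xi>1 * \<xi>2 + (a x)\<^sup>2 * V) =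
    (Omega_of f x)\<^sup>2 * (- F_of f x * (\<tau>1 * \<tau>2) + (dr * \<xi>1) * (dr * \<xi>2) / F_of f x + V)"
proof -
  have pos: "0 < a x" "0 < sin x" using assms a_pos sin_pos by auto
  then have "dr = - (1 / sin x)\<^sup>2"
    using DERIV_unique[OF assms(2) DERIV_r_of] by simp
  with pos show ?thesis
    unfolding G_eq[OF assms(1)] Omega_eq[OF assms(1)] F_eq[OF assms(1)]
    by (simp add: field_simps eval_nat_numeral)
qed

end

section \<open>Assembly of the conditions on the extended spacetime\<close>

theorem theoremB1:
  fixes f :: "real \<Rightarrow> real" and x0 :: real and D :: "real set"
  assumes n2: "CARD('n::finite) \<ge> 2"
    and x0: "0 < x0" "x0 < pi / 2"
    and D: "open D" "{r_of x0..} \<subseteq> D"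
    and f_smooth: "smooth_on D f" and f_pos: "\<forall>r\<in>D. f r > 0"
    and a_smooth: "smooth_on {0<..<x0} (a_of f)"
    and a_asym: "(\<lambda>x. a_of f x - x) \<in> O[at_right 0](\<lambda>x. x ^ 2)"
    and a'_asym: "(\<lambda>x. deriv (a_of f) x - 1) \<in> O[at_right 0](\<lambda>x. x)"
  shows "\<exists>(gbar :: real \<times> (real^'n) \<Rightarrow> real \<times> (real^'n) \<Rightarrow> real \<times> (real^'n) \<Rightarrow> real)
           (Omegabar :: real \<times> (real^'n) \<Rightarrow> real).
    inj_on (Phi f x0) (M_coords x0) \<and>
    Phi f x0 ` (M_coords x0 :: (real \<times> real \<times> (real^'n)) set) = Mbar - J_set \<and>
    Mbar \<inter> frontier (Phi f x0 ` (M_coords x0 :: (real \<times> real \<times> (real^'n)) set)) = J_set \<and>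
    (\<forall>q\<in>Mbar. lorentzian_form (gbar q)) \<and>
    (\<forall>u v. locally_lipschitz_on Mbar (\<lambda>q. gbar q u v)) \<and>
    (\<forall>t x w db. (t, x, w) \<in> M_coords x0 \<longrightarrow> (b_of f x0 has_real_derivative db) (at x) \<longrightarrow>
       (\<forall>\<tau>1 \<xi>1 v1 \<tau>2 \<xi>2 v2. w \<bullet> v1 = 0 \<longrightarrow> w \<bullet> v2 = 0 \<longrightarrow>
          gbar (Phi f x0 (t, x, w))
               (\<tau>1, (db * \<xi>1) *\<^sub>R w + b_of f x0 x *\<^sub>R v1)
               (\<tau>2, (db * \<xi>2) *\<^sub>R w + b_of f x0 x *\<^sub>R v2)
          = - (\<tau>1 * \<tau>2) + (G_of f x)^2 * (\<xi>1 * \<xi>2 + (a_of f x)^2 * (v1 \<bullet> v2)))) \<and>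
    smooth_map_on UNIV (\<lambda>t::real. (t, 0::real^'n)) \<and>
    range (\<lambda>t::real. (t, 0::real^'n)) = J_set \<and>
    \<not> (\<exists>q\<in>Mbar. ((\<lambda>t::real. (t, 0::real^'n)) \<longlongrightarrow> q) at_top) \<and>
    \<not> (\<exists>q\<in>Mbar. ((\<lambda>t::real. (t, 0::real^'n)) \<longlongrightarrow> q) at_bot) \<and>
    (\<forall>t. gbar (t, 0) (1, 0) (1, 0) < 0) \<and>
    continuous_on Mbar Omegabar \<and>
    (\<forall>q\<in>J_set. Omegabar q = 0) \<and>
    (\<forall>p\<in>M_coords x0. Omegabar (Phi f x0 p) = Omega_of f (fst (snd p))) \<and>
    (\<forall>q\<in>Mbar - J_set. Omegabar q > 0) \<and>
    smooth_on (Mbar - J_set) Omegabar \<and>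
    (\<forall>p\<in>J_set. \<exists>U. open U \<and> p \<in> U \<and> connected (U \<inter> J_set) \<and>
       (\<exists>C. \<forall>q\<in>(U \<inter> Mbar) - J_set. \<exists>L. (Omegabar has_derivative L) (at q) \<and> onorm L \<le> C)) \<and>
    (\<forall>t x w db dr. (t, x, w) \<in> M_coords x0 \<longrightarrow> (b_of f x0 has_real_derivative db) (at x) \<longrightarrow>
       (r_of has_real_derivative dr) (at x) \<longrightarrow>
       (\<forall>\<tau>1 \<xi>1 v1 \<tau>2 \<xi>2 v2. w \<bullet> v1 = 0 \<longrightarrow> w \<bullet> v2 = 0 \<longrightarrow>
          gbar (Phi f x0 (t, x, w))
               (\<tau>1, (db * \<xi>1) *\<^sub>R w + b_of f x0 x *\<^sub>R v1)
               (\<tau>2, (db * \<xi>2) *\<^sub>R w + b_of f x0 x *\<^sub>R v2)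
          = (Omegabar (Phi f x0 (t, x, w)))^2 *
            (- F_of f x * (\<tau>1 * \<tau>2) + (dr * \<xi>1) * (dr * \<xi>2) / F_of f x + v1 \<bullet> v2)))"
proof -
  interpret radial_profile f x0 D
  proof
    show "continuous_on D f"
      using smooth_on_differentiable[OF f_smooth]
      by (intro continuous_at_imp_continuous_on) (auto intro: differentiable_imp_continuous_within)
  qed (use assms in auto)
  let ?g = "\<lambda>(q :: real \<times> (real^'n)) (u :: real \<times> (real^'n)) (v :: real \<times> (real^'n)).
    - (fst u * fst v) + conf (norm (snd q)) * (snd u \<bullet> snd v)"
  let ?\<Omega> = "\<lambda>q :: real \<times> (real^'n). omega (norm (snd q))"
  have \<Omega>_Phi: "?\<Omega> (Phi f x0 (t, x, w)) = Omega_of f x" if "(t, x, w) \<in> M_coords x0" for t x w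
    using that b_pos[of x] by (auto simp: M_coords_def snd_Phi omega_b Omega_eq)
  have \<Omega>_lip: "locally_lipschitz_on Mbar ?\<Omega>"
    by (rule locally_lipschitz_on_Mbar_radial) (blast elim: omega_lipschitz_deriv_bound)
  have d\<Omega>: "\<exists>U. open U \<and> p \<in> U \<and> connected (U \<inter> J_set) \<and>
      (\<exists>C. \<forall>q\<in>U \<inter> Mbar - J_set. \<exists>L. (?\<Omega> has_derivative L) (at q) \<and> onorm L \<le> C)"
    if "p \<in> J_set" for p
  \<comment> \<open>One tube around the entire axis works for every p; it meets \<open>J_set\<close>
    in the whole line, which is connected.\<close>
  proof (intro exI[of _ "UNIV \<times> ball 0 (1 / 2)"] conjI)
    have "(UNIV \<times> ball 0 (1 / 2)) \<inter> J_set = UNIV \<times> {0 :: real^'n}"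
      by (auto simp: J_set_def)
    then show "connected ((UNIV \<times> ball 0 (1 / 2)) \<inter> (J_set :: (real \<times> (real^'n)) set))"
      by (simp add: connected_Times)
    obtain C where C: "\<And>q. 0 < norm (snd q) \<Longrightarrow> norm (snd q) < 1 / 2 \<Longrightarrow>
        \<exists>L. (?\<Omega> has_derivative L) (at q) \<and> onorm L \<le> C"
      using omega_norm_derivative_bound by blast
    show "\<exists>C. \<forall>q\<in>UNIV \<times> ball 0 (1 / 2) \<inter> Mbar - J_set.
        \<exists>L. (?\<Omega> has_derivative L) (at q) \<and> onorm L \<le> C"
      by (intro exI[of _ C] ballI C) (auto simp: J_set_def)
  qed (use that in \<open>auto simp: J_set_def open_Times\<close>)
  show ?thesis
  proof (intro exI[of _ ?g] exI[of _ ?\<Omega>] conjI)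
    show "Phi f x0 ` M_coords x0 = (Mbar - J_set :: (real \<times> (real^'n)) set)"
      by (rule Phi_image)
    show "Mbar \<inter> frontier (Phi f x0 ` M_coords x0) = (J_set :: (real \<times> (real^'n)) set)"
      unfolding Phi_image by (rule Mbar_inter_frontier)
    show "\<forall>q\<in>Mbar. lorentzian_form (?g q)"
      by (intro ballI lorentzian_form_conformal conf_pos) (auto simp: Mbar_def)
    show "\<forall>u v. locally_lipschitz_on Mbar (\<lambda>q. ?g q u v)"
      by (intro allI locally_lipschitz_on_affine locally_lipschitz_on_Mbar_radial conf_lipschitz)
    show "smooth_map_on UNIV (\<lambda>t::real. (t, 0::real^'n))"
      by (rule smooth_map_on_axis)
    show "range (\<lambda>t::real. (t, 0::real^'n)) = J_set"
      by (auto simp: J_set_def)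
    show "\<not> (\<exists>q\<in>Mbar. ((\<lambda>t::real. (t, 0::real^'n)) \<longlongrightarrow> q) at_top)"
      "\<not> (\<exists>q\<in>Mbar. ((\<lambda>t::real. (t, 0::real^'n)) \<longlongrightarrow> q) at_bot)"
      using axis_not_tendsto by blast+
    show "\<forall>t. ?g (t, 0) (1, 0) (1, 0) < 0"
      by simp
    show "continuous_on Mbar ?\<Omega>"
      using \<Omega>_lip by (rule locally_lipschitz_on_imp_continuous_on)
    show "\<forall>q\<in>J_set. ?\<Omega> q = 0"
      by (auto simp: J_set_def omega_def radial_def)
    show "\<forall>p\<in>M_coords x0. ?\<Omega> (Phi f x0 p) = Omega_of f (fst (snd p))"
      using \<Omega>_Phi by (metis prod.collapse)
    show "\<forall>q\<in>Mbar - J_set. ?\<Omega> q > 0"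
      by (auto simp: Mbar_def J_set_def intro!: omega_pos)
    show "smooth_on (Mbar - J_set) ?\<Omega>"
      by (rule omega_norm_smooth)
    show "\<forall>p\<in>J_set. \<exists>U. open U \<and> p \<in> U \<and> connected (U \<inter> J_set) \<and>
        (\<exists>C. \<forall>q\<in>U \<inter> Mbar - J_set. \<exists>L. (?\<Omega> has_derivative L) (at q) \<and> onorm L \<le> C)"
      using d\<Omega> by blast
    show "\<forall>t x w db. (t, x, w) \<in> M_coords x0 \<longrightarrow> (b_of f x0 has_real_derivative db) (at x) \<longrightarrow>
       (\<forall>\<tau>1 \<xi>1 v1 \<tau>2 \<xi>2 v2. w \<bullet> v1 = 0 \<longrightarrow> w \<bullet> v2 = 0 \<longrightarrow>
          ?g (Phi f x0 (t, x, w))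
               (\<tau>1, (db * \<xi>1) *\<^sub>R w + b_of f x0 x *\<^sub>R v1)
               (\<tau>2, (db * \<xi>2) *\<^sub>R w + b_of f x0 x *\<^sub>R v2)
          = - (\<tau>1 * \<tau>2) + (G_of f x)^2 * (\<xi>1 * \<xi>2 + (a_of f x)^2 * (v1 \<bullet> v2)))"
      unfolding fst_conv snd_conv
      \<comment> \<open>The time parts coincide literally, so only the spatial summand is left for
        \<open>pullback_metric\<close>.\<close>
      by (intro allI impI arg_cong2[where f = "(+)"] refl pullback_metric)
    show "\<forall>t x w db dr. (t, x, w) \<in> M_coords x0 \<longrightarrow> (b_of f x0 has_real_derivative db) (at x) \<longrightarrow>
       (r_of has_real_derivative dr) (at x) \<longrightarrow>
       (\<forall>\<tau>1 \<xi>1 v1 \<tau>2 \<xi>2 v2. w \<bullet> v1 = 0 \<longrightarrow> w \<bullet> v2 = 0 \<longrightarrow>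
          ?g (Phi f x0 (t, x, w))
               (\<tau>1, (db * \<xi>1) *\<^sub>R w + b_of f x0 x *\<^sub>R v1)
               (\<tau>2, (db * \<xi>2) *\<^sub>R w + b_of f x0 x *\<^sub>R v2)
          = (?\<Omega> (Phi f x0 (t, x, w)))^2 *
            (- F_of f x * (\<tau>1 * \<tau>2) + (dr * \<xi>1) * (dr * \<xi>2) / F_of f x + v1 \<bullet> v2))"
    proof (intro allI impI)
      fix t x db dr \<tau>1 \<xi>1 \<tau>2 \<xi>2 and w v1 v2 :: "real^'n"
      assume 1: "(t, x, w) \<in> M_coords x0" "(b_of f x0 has_real_derivative db) (at x)"
        and dr: "(r_of has_real_derivative dr) (at x)" and 2: "w \<bullet> v1 = 0" "w \<bullet> v2 = 0"
      have "x \<in> I" using 1 by (simp add: M_coords_def)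
      show "?g (Phi f x0 (t, x, w))
               (\<tau>1, (db * \<xi>1) *\<^sub>R w + b_of f x0 x *\<^sub>R v1)
               (\<tau>2, (db * \<xi>2) *\<^sub>R w + b_of f x0 x *\<^sub>R v2)
          = (?\<Omega> (Phi f x0 (t, x, w)))^2 *
            (- F_of f x * (\<tau>1 * \<tau>2) + (dr * \<xi>1) * (dr * \<xi>2) / F_of f x + v1 \<bullet> v2)"
        unfolding fst_conv snd_conv pullback_metric[OF 1 2] \<Omega>_Phi[OF 1(1)]
        by (rule conformal_identity[OF \<open>x \<in> I\<close> dr])
    qed
  qed (rule Phi_inj)
qed


end
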